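(* (Bright-dark/bright-anti-dark/resonant breather solutions.) Let $\sigma=\pm1$, $a_1\in\mathbb R\setminus\{0\}$, $b_1\in\mathbb R\setminus\{0\}$, $\lambda_1\in\mathbb C\setminus(\mathbb R\cup\mathrm i\mathbb R)$, $z_1=\lambda_1^{-2}$, $c_1,c_2,c_3\in\mathbb C$. Let $\kappa_1,\kappa_2$ be the roots of $(\kappa/z_1-2)(\kappa+b_1)+a_1^2b_1^2=0$, $\kappa_3=-b_1$, $\omega_1=b_1x-\big(a_1^2-\frac1{b_1}\big)t$ and $\vartheta_i=\mathrm i(\kappa_i-z_1)\Big[x+\frac{1}{2b_1^2z_1}(\kappa_i-z_1+2b_1)t\Big]$, $i=1,2,3$. Then, wherever the denominator $M_1$ is nonzero, $$u_1[1]=a_1\frac{N_1}{M_1}\mathrm e^{\mathrm i\omega_1},\qquad u_2[1]=\frac{N_2}{M_1}\mathrm e^{\mathrm i\omega_1},\qquad N_2=c_3\lambda_1\big(c_1^*\mathrm e^{\vartheta_3+\vartheta_1^*}+c_2^*\mathrm e^{\vartheta_3+\vartheta_2^*}\big),$$ solve the coupled Fokas–Lenells equation $$u_{1,xt}+u_1+\mathrm i(|u_1|^2+\tfrac12\sigma|u_2|^2)u_{1,x}+\tfrac{\mathrm i}{2}\sigma u_1u_2^*u_{2,x}=0,\qquad u_{2,xt}+u_2+\mathrm i(\sigma|u_2|^2+\tfrac12|u_1|^2)u_{2,x}+\tfrac{\mathrm i}{2}u_2u_1^*u_{1,x}=0,$$ where: (i) if $2b_1-a_1^2b_1^2\ne0$,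 $$N_1=\sum_{l,m=1}^{2}\frac{\kappa_l^*+b_1}{\kappa_m+b_1}\frac{c_mc_l^*\kappa_m\mathrm e^{\vartheta_m+\vartheta_l^*}}{\kappa_m-\kappa_l^*}+\frac{\sigma|c_3|^2|z_1|}{z_1^*-z_1}\mathrm e^{\vartheta_3+\vartheta_3^*},\quad M_1=\sum_{l,m=1}^{2}\frac{c_mc_l^*\kappa_l^*\mathrm e^{\vartheta_m+\vartheta_l^*}}{\kappa_m-\kappa_l^*}+\frac{\sigma|c_3|^2|z_1|}{z_1^*-z_1}\mathrm e^{\vartheta_3+\vartheta_3^*};$$ (ii) if $2b_1-a_1^2b_1^2=0$ (so that one takes $\kappa_1=2z_1-b_1$, $\kappa_2=0$), $N_1$ and $M_1$ are given by the same formulas except that the terms with $l=m=2$ are replaced by $\frac{|c_2|^2z_1^2(a_1^2z_1^*-1)}{|z_1|^2-z_1^2}\mathrm e^{\vartheta_2+\vartheta_2^*}$ in $N_1$ and by $\frac{|c_2|^2|z_1|^2(a_1^2z_1-1)}{|z_1|^2-z_1^2}\mathrm e^{\vartheta_2+\vartheta_2^*}$ in $M_1$.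
   Context: $^*$ denotes complex conjugation. The seed solution is the plane wave $u_1=a_1\mathrm e^{\mathrm i\omega_1}$, $u_2=0$ (with $b_2=b_1$, $a_2=0$). *)

theory Defs
  imports "HOL-Analysis.Analysis"
begin

definition Dx :: "(real \<Rightarrow> real \<Rightarrow> complex) \<Rightarrow> real \<Rightarrow> real \<Rightarrow> complex" where
  "Dx u x t = vector_derivative (\<lambda>s. u s t) (at x)"

definition Dt :: "(real \<Rightarrow> real \<Rightarrow> complex) \<Rightarrow> real \<Rightarrow> real \<Rightarrow> complex" where
  "Dt u x t = vector_derivative (\<lambda>s. u x s) (at t)"

(* vector_derivative is total, so the existence of u_x, u_t and u_xt has to be demanded
   explicitly. Since all of these are continuous on an open set, Schwarz's theorem makes the
   order of differentiation in u_xt immaterial. *)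
definition xt_regular_on :: "(real \<times> real) set \<Rightarrow> (real \<Rightarrow> real \<Rightarrow> complex) \<Rightarrow> bool" where
  "xt_regular_on D u \<longleftrightarrow>
     (\<forall>(x, t) \<in> D. (\<lambda>s. u s t) differentiable (at x)
                 \<and> (\<lambda>s. u x s) differentiable (at t)
                 \<and> (\<lambda>s. Dx u x s) differentiable (at t))
     \<and> continuous_on D (\<lambda>(x, t). u x t)
     \<and> continuous_on D (\<lambda>(x, t). Dx u x t)
     \<and> continuous_on D (\<lambda>(x, t). Dt u x t)
     \<and> continuous_on D (\<lambda>(x, t). Dt (Dx u) x t)"

definition coupled_FL_solution_on ::
  "real \<Rightarrow> (real \<times> real) set \<Rightarrow> (real \<Rightarrow> real \<Rightarrow> complex) \<Rightarrow> (real \<Rightarrow> real \<Rightarrow> complex) \<Rightarrow> bool" where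
  "coupled_FL_solution_on \<sigma> D u1 u2 \<longleftrightarrow>
     open D \<and> xt_regular_on D u1 \<and> xt_regular_on D u2 \<and>
     (\<forall>(x, t) \<in> D.
        Dt (Dx u1) x t + u1 x t
          + \<i> * complex_of_real ((cmod (u1 x t))\<^sup>2 + 1/2 * \<sigma> * (cmod (u2 x t))\<^sup>2) * Dx u1 x t
          + \<i> / 2 * complex_of_real \<sigma> * u1 x t * cnj (u2 x t) * Dx u2 x t = 0
      \<and> Dt (Dx u2) x t + u2 x t
          + \<i> * complex_of_real (\<sigma> * (cmod (u2 x t))\<^sup>2 + 1/2 * (cmod (u1 x t))\<^sup>2) * Dx u2 x t
          + \<i> / 2 * u2 x t * cnj (u1 x t) * Dx u1 x t = 0)"

end

(*
  The Darboux-dressed solution depends on the spectral data only through three functions: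
  p = sum of c_m exp(theta_m), q = sum of c_m exp(theta_m) / (kappa_m + b_1) for m = 1, 2,
  and X = lambda_1 c_3 exp(theta_3). They solve linear ODEs in x and in t, and with w = 1/z_1
  (so w = lambda_1^2) and a prime for conjugation
    (w' - w) M_1 = w |p|^2 - a_1^2 b_1^2 |q|^2 - sigma |X|^2,
    N_1 = M_1 + b_1 q p',   N_2 = X p'.
  This form has no divisors kappa_m - kappa_l', so it also covers the degenerate case and a double
  root. It yields M_1 + M_1' = -|p|^2, hence, with h = z_1' (2 p' - a_1^2 b_1^2 q'),
    u_1x = -i a_1 b_1 (M_1' / M_1^2) (M_1 - q h) exp(i omega_1),
    u_2x = i (M_1' / M_1^2) X h exp(i omega_1),
  and multiplying the two equations by M_1^3 leaves polynomial identities.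
*)
theory Submission
  imports Defs
begin

section \<open>Polynomial and rational identities behind the two equations\<close>

text \<open>
  In the two identities below \<open>P\<close>, \<open>Q\<close>, \<open>m\<close> and \<open>m'\<close> stand for the \<open>t\<close>-derivatives of \<open>p\<close>, \<open>q\<close>, \<open>M\<close>
  and \<open>M'\<close> divided by \<open>\<i>/2\<close>, and \<open>P'\<close>, \<open>Q'\<close>, \<open>k\<close> for those of \<open>p'\<close>, \<open>q'\<close>, \<open>h\<close> divided by \<open>-\<i>/2\<close>.
  Primed letters are conjugates, and \<open>S\<close> is \<open>\<sigma> |X|\<^sup>2\<close>.
\<close>

lemma first_equation_identity:
  fixes z w z' w' p p' q q' M a2 b \<beta> :: complex
  assumes "b * \<beta> = 1" "z * w = 1" "z' * w' = 1"
    and S: "S = w * p * p' - a2 * b\<^sup>2 * q * q' - (w' - w) * M"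
    and M': "M' = - M - p * p'"
    and P: "P = (2 * \<beta> + z * \<beta>\<^sup>2 - a2) * p - a2 * b * q"
    and Q: "Q = \<beta> * w * p + (z * \<beta>\<^sup>2 - w - a2) * q"
    and P': "P' = (2 * \<beta> + z' * \<beta>\<^sup>2 - a2) * p' - a2 * b * q'"
    and Q': "Q' = \<beta> * w' * p' + (z' * \<beta>\<^sup>2 - w' - a2) * q'"
    and m: "m = ((z - z') * \<beta>\<^sup>2 + w' - w) * M - w * p * p' + a2 * b * q * p'"
    and m': "m' = - m - P * p' + p * P'"
    and h: "h = z' * (2 * p' - a2 * b\<^sup>2 * q')"
    and k: "k = z' * (2 * P' - a2 * b\<^sup>2 * Q')"
    and n: "n = M + b * q * p'"
    and n': "n' = M' + b * q' * p"
  shows "- 2 * (a2 * b - 1) * M' * (M - q * h) * M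
     + b * (M * (m' * (M - q * h) + M' * (m - Q * h + q * k)) - 2 * m * M' * (M - q * h))
     + 2 * n * M\<^sup>2 + b * (2 * a2 * n * n' + S * p * p') * (M - q * h) - S * n * p * h = 0"
  using assms(1-3) unfolding S m' P Q P' Q' k m n n' h M'
  by algebra

lemma second_equation_identity:
  fixes z w z' w' p p' q q' M a2 b \<beta> :: complex
  assumes "b * \<beta> = 1" "z * w = 1" "z' * w' = 1"
    and S: "S = w * p * p' - a2 * b\<^sup>2 * q * q' - (w' - w) * M"
    and M': "M' = - M - p * p'"
    and P: "P = (2 * \<beta> + z * \<beta>\<^sup>2 - a2) * p - a2 * b * q"
    and Q: "Q = \<beta> * w * p + (z * \<beta>\<^sup>2 - w - a2) * q"
    and P': "P' = (2 * \<beta> + z' * \<beta>\<^sup>2 - a2) * p' - a2 * b * q'"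
    and Q': "Q' = \<beta> * w' * p' + (z' * \<beta>\<^sup>2 - w' - a2) * q'"
    and m: "m = ((z - z') * \<beta>\<^sup>2 + w' - w) * M - w * p * p' + a2 * b * q * p'"
    and m': "m' = - m - P * p' + p * P'"
    and h: "h = z' * (2 * p' - a2 * b\<^sup>2 * q')"
    and k: "k = z' * (2 * P' - a2 * b\<^sup>2 * Q')"
    and n: "n = M + b * q * p'"
    and n': "n' = M' + b * q' * p"
  shows "2 * (a2 - \<beta>) * M' * h * M
     - (M * (m' * h + M' * (z * \<beta>\<^sup>2 - w) * h - M' * k) - 2 * m * M' * h)
     + 2 * p' * M\<^sup>2 - (2 * S * p * p' + a2 * n * n') * h + a2 * b * p' * n' * (M - q * h) = 0"
  using assms(1-3) unfolding S m' P Q P' Q' k m n n' h M'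
  by algebra

text \<open>Multiplying by \<open>2 * M ^ 3\<close> leaves \<open>a * e\<close> times the polynomial
  of \<open>F\<close>: each \<open>M'\<close> in a denominator cancels against the factor
  \<open>M'\<close> that both x-derivatives carry, and \<open>b * \<beta> = 1\<close> absorbs the
  remaining \<open>\<beta>\<close>. Keeping \<open>\<Gamma>\<close>, \<open>m\<close>,
  \<open>h\<close>, \<open>n\<close> opaque separates the clearing of denominators from the large
  polynomial identity.\<close>

lemma first_equation_quotients:
  fixes M M' :: complex
  assumes "M \<noteq> 0" "M' \<noteq> 0" "b * \<beta> = 1"
    and F: "- 2 * (a2 * b - 1) * M' * (M - q * h) * M
     + b * (M * \<Gamma> - 2 * m * M' * (M - q * h))
     + 2 * n * M\<^sup>2 + b * (2 * a2 * n * n' + \<sigma> * X * X' * p * p') * (M - q * h)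
     - \<sigma> * X * X' * n * p * h = 0"
  shows "- (\<i> * a * b * (\<i> * (\<beta> - a2) * (M' * (M - q * h) / M\<^sup>2)
            + \<i> / 2 * (M * \<Gamma> - 2 * m * M' * (M - q * h)) / M ^ 3) * e)
     + a * (n / M) * e
     + \<i> * (a2 * n * n' / (M * M') + \<sigma> / 2 * X * X' * p * p' / (M * M'))
         * (- (\<i> * a * b * (M' * (M - q * h) / M\<^sup>2) * e))
     + \<i> / 2 * \<sigma> * (a * n * X' * p / (M * M')) * (\<i> * (M' * X * h / M\<^sup>2) * e) = 0"
    (is "?L = 0")
proof -
  have "?L * (2 * M ^ 3) = a * e * (- 2 * (a2 * b - 1) * M' * (M - q * h) * M
     + b * (M * \<Gamma> - 2 * m * M' * (M - q * h))
     + 2 * n * M\<^sup>2 + b * (2 * a2 * n * n' + \<sigma> * X * X' * p * p') * (M - q * h)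
     - \<sigma> * X * X' * n * p * h)"
    using assms(1-3) by (simp add: divide_simps) (use i_squared in algebra)
  then show ?thesis using F assms(1) by simp
qed

text \<open>Same clearing of denominators, now with common factor \<open>X * e\<close>. The cross
  term multiplies the amplitudes of the conjugated first field and of its x-derivative, which is
  where \<open>a * a\<close> meets \<open>a2\<close>.\<close>

lemma second_equation_quotients:
  fixes M M' :: complex
  assumes "M \<noteq> 0" "M' \<noteq> 0" "a2 = a * a"
    and F: "2 * (a2 - \<beta>) * M' * h * M - (M * \<Lambda> - 2 * m * M' * h) + 2 * p' * M\<^sup>2
     - (2 * (\<sigma> * X * X') * p * p' + a2 * n * n') * h + a2 * b * p' * n' * (M - q * h) = 0"
  shows "\<i> * (\<i> * (\<beta> - a2) * (M' * X * h / M\<^sup>2)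
            + \<i> / 2 * X * (M * \<Lambda> - 2 * m * M' * h) / M ^ 3) * e
     + X * p' / M * e
     + \<i> * (\<sigma> * X * X' * p * p' / (M * M') + 1 / 2 * (a2 * n * n' / (M * M')))
         * (\<i> * (M' * X * h / M\<^sup>2) * e)
     + \<i> / 2 * (a * X * p' * n' / (M * M')) * (- (\<i> * a * b * (M' * (M - q * h) / M\<^sup>2) * e)) = 0"
    (is "?L = 0")
proof -
  have "?L * (2 * M ^ 3) = X * e * (2 * (a2 - \<beta>) * M' * h * M - (M * \<Lambda> - 2 * m * M' * h) + 2 * p' * M\<^sup>2
     - (2 * (\<sigma> * X * X') * p * p' + a2 * n * n') * h + a2 * b * p' * n' * (M - q * h))"
    using assms(1-3) by (simp add: divide_simps) (use i_squared in algebra)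
  then show ?thesis using F assms(1) by simp
qed

section \<open>Differentiation rules and a criterion for solutions\<close>

lemma has_vector_derivative_quotient:
  fixes f g :: "real \<Rightarrow> 'a::real_normed_field"
  assumes f: "(f has_vector_derivative f') (at x)" and g: "(g has_vector_derivative g') (at x)"
    and nz: "g x \<noteq> 0"
  shows "((\<lambda>s. f s / g s) has_vector_derivative (f' * g x - f x * g') / (g x)\<^sup>2) (at x)"
proof -
  have "((\<lambda>s. inverse (g s)) has_vector_derivative - g' / (g x)\<^sup>2) (at x)"
    using field_vector_diff_chain_at[OF g DERIV_inverse[OF nz]]
    by (simp add: o_def field_simps power2_eq_square)
  from has_vector_derivative_mult[OF f this] show ?thesis
    unfolding divide_inverse[of "f _"]
    by (rule has_vector_derivative_eq_rhs) (use nz in \<open>simp add: field_simps power2_eq_square\<close>)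
qed

lemma has_vector_derivative_exp_affine:
  fixes A B :: "'a::{real_normed_field,banach}"
  shows "((\<lambda>s. exp (A * of_real s + B)) has_vector_derivative A * exp (A * of_real x + B)) (at x)"
  by (rule has_vector_derivative_real_field) (auto intro!: derivative_eq_intros)

text \<open>Replaces the total operators \<open>Dx\<close> and \<open>Dt\<close> by explicit
  candidates with genuine derivatives, so that regularity and the equations can be checked on closed
  formulas.\<close>

lemma coupled_FL_solution_onI:
  assumes D: "open D"
    and u1x: "\<And>x t. (x, t) \<in> D \<Longrightarrow> ((\<lambda>s. u1 s t) has_vector_derivative u1x x t) (at x)"
    and u1t: "\<And>x t. (x, t) \<in> D \<Longrightarrow> ((\<lambda>s. u1 x s) has_vector_derivative u1t x t) (at t)"
    and u1xt: "\<And>x t. (x, t) \<in> D \<Longrightarrow> ((\<lambda>s. u1x x s) has_vector_derivative u1xt x t) (at t)"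
    and u2x: "\<And>x t. (x, t) \<in> D \<Longrightarrow> ((\<lambda>s. u2 s t) has_vector_derivative u2x x t) (at x)"
    and u2t: "\<And>x t. (x, t) \<in> D \<Longrightarrow> ((\<lambda>s. u2 x s) has_vector_derivative u2t x t) (at t)"
    and u2xt: "\<And>x t. (x, t) \<in> D \<Longrightarrow> ((\<lambda>s. u2x x s) has_vector_derivative u2xt x t) (at t)"
    and cont: "continuous_on D (\<lambda>(x, t). u1x x t)" "continuous_on D (\<lambda>(x, t). u1t x t)"
      "continuous_on D (\<lambda>(x, t). u1xt x t)" "continuous_on D (\<lambda>(x, t). u1 x t)"
      "continuous_on D (\<lambda>(x, t). u2x x t)" "continuous_on D (\<lambda>(x, t). u2t x t)"
      "continuous_on D (\<lambda>(x, t). u2xt x t)" "continuous_on D (\<lambda>(x, t). u2 x t)"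
    and eq1: "\<And>x t. (x, t) \<in> D \<Longrightarrow> u1xt x t + u1 x t
          + \<i> * complex_of_real ((cmod (u1 x t))\<^sup>2 + 1/2 * \<sigma> * (cmod (u2 x t))\<^sup>2) * u1x x t
          + \<i> / 2 * complex_of_real \<sigma> * u1 x t * cnj (u2 x t) * u2x x t = 0"
    and eq2: "\<And>x t. (x, t) \<in> D \<Longrightarrow> u2xt x t + u2 x t
          + \<i> * complex_of_real (\<sigma> * (cmod (u2 x t))\<^sup>2 + 1/2 * (cmod (u1 x t))\<^sup>2) * u2x x t
          + \<i> / 2 * u2 x t * cnj (u1 x t) * u1x x t = 0"
  shows "coupled_FL_solution_on \<sigma> D u1 u2"
proof -
  have slice: "open {s. (x, s) \<in> D}" for x
  proof -
    have "{s. (x, s) \<in> D} = (\<lambda>s. (x, s)) -` D" by auto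
    then show ?thesis
      using D by (auto intro!: open_vimage continuous_intros)
  qed
  have *: "xt_regular_on D u \<and> (\<forall>(x, t)\<in>D. Dx u x t = ux x t \<and> Dt (Dx u) x t = uxt x t)"
    if ux: "\<And>x t. (x, t) \<in> D \<Longrightarrow> ((\<lambda>s. u s t) has_vector_derivative ux x t) (at x)"
      and ut: "\<And>x t. (x, t) \<in> D \<Longrightarrow> ((\<lambda>s. u x s) has_vector_derivative ut x t) (at t)"
      and uxt: "\<And>x t. (x, t) \<in> D \<Longrightarrow> ((\<lambda>s. ux x s) has_vector_derivative uxt x t) (at t)"
      and c: "continuous_on D (\<lambda>(x, t). ux x t)" "continuous_on D (\<lambda>(x, t). ut x t)"
      "continuous_on D (\<lambda>(x, t). uxt x t)" "continuous_on D (\<lambda>(x, t). u x t)"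
    for u ux ut uxt
  proof -
    have Dx: "Dx u x t = ux x t" if "(x, t) \<in> D" for x t
      using ux[OF that] unfolding Dx_def by (rule vector_derivative_at)
    have Dt: "Dt u x t = ut x t" if "(x, t) \<in> D" for x t
      using ut[OF that] unfolding Dt_def by (rule vector_derivative_at)
    \<comment> \<open>\<open>Dx u\<close> and \<open>ux\<close> agree only on \<open>D\<close>, yet
      a t-derivative looks at nearby times; openness of the vertical slice of \<open>D\<close> makes
      the exchange legitimate.\<close>
    have Dxt: "((\<lambda>s. Dx u x s) has_vector_derivative uxt x t) (at t)" if "(x, t) \<in> D" for x t
      by (rule has_vector_derivative_transform_within_open[OF uxt[OF that] slice[of x]])
         (use that Dx in auto)
    have DtDx: "Dt (Dx u) x t = uxt x t" if "(x, t) \<in> D" for x t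
      using Dxt[OF that] unfolding Dt_def by (rule vector_derivative_at)
    have "continuous_on D (\<lambda>(x, t). Dx u x t)"
      using c(1) by (rule continuous_on_eq) (auto simp: Dx)
    moreover have "continuous_on D (\<lambda>(x, t). Dt u x t)"
      using c(2) by (rule continuous_on_eq) (auto simp: Dt)
    moreover have "continuous_on D (\<lambda>(x, t). Dt (Dx u) x t)"
      using c(3) by (rule continuous_on_eq) (auto simp: DtDx)
    moreover have "\<forall>(x, t)\<in>D. (\<lambda>s. u s t) differentiable (at x)
        \<and> (\<lambda>s. u x s) differentiable (at t) \<and> (\<lambda>s. Dx u x s) differentiable (at t)"
      using differentiableI_vector[OF ux] differentiableI_vector[OF ut] differentiableI_vector[OF Dxt]
      by blast
    ultimately show ?thesis
      unfolding xt_regular_on_def using c(4) Dx DtDx by blast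
  qed
  note reg1 = *[OF u1x u1t u1xt cont(1-4)] and reg2 = *[OF u2x u2t u2xt cont(5-8)]
  show ?thesis
    unfolding coupled_FL_solution_on_def using D reg1 reg2 eq1 eq2 by fastforce
qed

section \<open>The dressed solution derived from the linear equations alone\<close>

text \<open>Roots, exponentials and \<lambda>_1 itself do not occur here, so both cases of the
  theorem become instances of a single computation. \<open>P\<close> and \<open>Q\<close> name the
  t-derivatives of \<open>p\<close> and \<open>q\<close> up to the factor \<open>\<i> / 2\<close>,
  which lets them stay opaque in the differentiation rules.\<close>

locale darboux_dressing =
  fixes \<sigma> a b \<beta> z w :: complex and p q X P Q :: "real \<Rightarrow> real \<Rightarrow> complex"
  assumes reals: "cnj \<sigma> = \<sigma>" "cnj a = a" "cnj b = b"
    and b_\<beta>: "b * \<beta> = 1" and z_w: "z * w = 1" and z_nonreal: "cnj z \<noteq> z"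
    and P: "P x t = (2 * \<beta> + z * \<beta>\<^sup>2 - a\<^sup>2) * p x t - a\<^sup>2 * b * q x t"
    and Q: "Q x t = \<beta> * w * p x t + (z * \<beta>\<^sup>2 - w - a\<^sup>2) * q x t"
    and p_x: "((\<lambda>s. p s t) has_vector_derivative \<i> * z * (p x t - a\<^sup>2 * b\<^sup>2 * q x t)) (at x)"
    and q_x: "((\<lambda>s. q s t) has_vector_derivative \<i> * (p x t - (b + z) * q x t)) (at x)"
    and X_x: "((\<lambda>s. X s t) has_vector_derivative - (\<i> * (b + z) * X x t)) (at x)"
    and p_t: "((\<lambda>s. p x s) has_vector_derivative \<i> / 2 * P x t) (at t)"
    and q_t: "((\<lambda>s. q x s) has_vector_derivative \<i> / 2 * Q x t) (at t)"
    and X_t: "((\<lambda>s. X x s) has_vector_derivative \<i> / 2 * (z * \<beta>\<^sup>2 - w) * X x t) (at t)"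
    and p_cont: "continuous_on UNIV (\<lambda>y. p (fst y) (snd y))"
    and q_cont: "continuous_on UNIV (\<lambda>y. q (fst y) (snd y))"
    and X_cont: "continuous_on UNIV (\<lambda>y. X (fst y) (snd y))"
begin

lemma \<beta>_real: "cnj \<beta> = \<beta>"
proof -
  have "b * cnj \<beta> = 1"
    using arg_cong[OF b_\<beta>, of cnj] by (simp add: reals)
  then show ?thesis
    using b_\<beta> by algebra
qed

lemma cnj_z_w: "cnj z * cnj w = 1"
  using arg_cong[OF z_w, of cnj] by simp

lemma w_nonreal: "cnj w - w \<noteq> 0"
  using z_w cnj_z_w z_nonreal by algebra

section \<open>The denominator, the numerator and their derivatives\<close>

definition M :: "real \<Rightarrow> real \<Rightarrow> complex" where
  "M x t = (w * p x t * cnj (p x t) - a\<^sup>2 * b\<^sup>2 * q x t * cnj (q x t) - \<sigma> * X x t * cnj (X x t))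
     / (cnj w - w)"

definition N :: "real \<Rightarrow> real \<Rightarrow> complex" where
  "N x t = M x t + b * q x t * cnj (p x t)"

definition h :: "real \<Rightarrow> real \<Rightarrow> complex" where
  "h x t = cnj z * (2 * cnj (p x t) - a\<^sup>2 * b\<^sup>2 * cnj (q x t))"

definition k :: "real \<Rightarrow> real \<Rightarrow> complex" where
  "k x t = cnj z * (2 * cnj (P x t) - a\<^sup>2 * b\<^sup>2 * cnj (Q x t))"

definition m :: "real \<Rightarrow> real \<Rightarrow> complex" where
  "m x t = ((z - cnj z) * \<beta>\<^sup>2 + cnj w - w) * M x t - w * p x t * cnj (p x t)
     + a\<^sup>2 * b * q x t * cnj (p x t)"

definition m' :: "real \<Rightarrow> real \<Rightarrow> complex" where
  "m' x t = - m x t - P x t * cnj (p x t) + p x t * cnj (P x t)"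

lemma M_eq: "(cnj w - w) * M x t =
    w * p x t * cnj (p x t) - a\<^sup>2 * b\<^sup>2 * q x t * cnj (q x t) - \<sigma> * X x t * cnj (X x t)"
  using w_nonreal by (simp add: M_def)

text \<open>In the right-hand side of \<open>M_eq\<close> only the coefficient \<open>w\<close> of
  |p|^2 fails to be real, so conjugation changes that side by (w' - w) |p|^2, while the factor w' -
  w on the left changes sign. This makes the conjugate of \<open>M\<close> a polynomial in
  \<open>M\<close>, \<open>p\<close> and p'.\<close>

lemma cnj_M: "cnj (M x t) = - M x t - p x t * cnj (p x t)"
proof -
  have "(cnj w - w) * cnj (M x t) = - cnj ((cnj w - w) * M x t)"
    by (simp add: algebra_simps)
  also have "\<dots> = (cnj w - w) * (- M x t - p x t * cnj (p x t))"
    unfolding right_diff_distrib mult_minus_right M_eq by (simp add: reals algebra_simps)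
  finally show ?thesis
    using w_nonreal by (metis mult_left_cancel)
qed

lemma M_x: "((\<lambda>s. M s t) has_vector_derivative
    \<i> * ((cnj z - z) * M x t + p x t * h x t)) (at x)"
  unfolding M_def[of _ t]
proof (rule has_vector_derivative_eq_rhs, (rule derivative_intros p_x q_x X_x)+, goal_cases)
  case 1
  \<comment> \<open>The product (w' - w) M is isolated so that \<open>M_eq\<close> can replace it,
    leaving a polynomial identity in \<open>p\<close>, \<open>q\<close>, \<open>X\<close> and their
    conjugates.\<close>
  have "\<i> * ((cnj z - z) * M x t + p x t * h x t) * (cnj w - w) =
      \<i> * ((cnj z - z) * ((cnj w - w) * M x t) + p x t * h x t * (cnj w - w))"
    by (simp add: algebra_simps)
  then show ?case
    unfolding M_eq M_def[symmetric] nonzero_divide_eq_eq[OF w_nonreal]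
    by (elim ssubst, unfold h_def, simp add: reals) (use z_w cnj_z_w in algebra)
qed

lemma M_t: "((\<lambda>s. M x s) has_vector_derivative \<i> / 2 * m x t) (at t)"
  unfolding M_def[of x]
proof (rule has_vector_derivative_eq_rhs, (rule derivative_intros p_t q_t X_t)+, goal_cases)
  case 1
  \<comment> \<open>an opaque constant: the Groebner basis computation does not cope with \<open>\<i> / 2\<close>\<close>
  define j where "j = \<i> / 2"
  have j: "cnj j = - j" by (simp add: j_def)
  have "j * m x t * (cnj w - w) = j * (((z - cnj z) * \<beta>\<^sup>2 + cnj w - w) * ((cnj w - w) * M x t)
    + (- w * p x t * cnj (p x t) + a\<^sup>2 * b * q x t * cnj (p x t)) * (cnj w - w))"
    unfolding m_def by (simp add: algebra_simps)
  then show ?case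
    unfolding M_eq nonzero_divide_eq_eq[OF w_nonreal] j_def[symmetric]
    by (elim ssubst, unfold P Q, simp only: complex_cnj_add complex_cnj_diff complex_cnj_mult
      complex_cnj_power j reals \<beta>_real complex_cnj_numeral complex_cnj_cnj)
      (use z_w cnj_z_w b_\<beta> in algebra)
qed

lemma cnj_M_t: "((\<lambda>s. cnj (M x s)) has_vector_derivative \<i> / 2 * m' x t) (at t)"
  unfolding cnj_M
  by (rule has_vector_derivative_eq_rhs, (rule derivative_intros M_t p_t)+)
     (simp add: m'_def algebra_simps)

lemma h_t: "((\<lambda>s. h x s) has_vector_derivative - (\<i> / 2 * k x t)) (at t)"
  unfolding h_def
  by (rule has_vector_derivative_eq_rhs, (rule derivative_intros p_t q_t)+)
     (simp add: k_def algebra_simps)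

lemma N_t: "((\<lambda>s. N x s) has_vector_derivative
    \<i> / 2 * (m x t + b * (Q x t * cnj (p x t) - q x t * cnj (P x t)))) (at t)"
  unfolding N_def
  by (rule has_vector_derivative_eq_rhs, (rule derivative_intros p_t q_t M_t)+)
     (simp add: algebra_simps)

section \<open>The two fields and their derivatives\<close>

definition e :: "real \<Rightarrow> real \<Rightarrow> complex" where
  "e x t = exp (\<i> * (b * x - (a\<^sup>2 - \<beta>) * t))"

lemma e_x: "((\<lambda>s. e s t) has_vector_derivative \<i> * b * e x t) (at x)"
  using has_vector_derivative_exp_affine[of "\<i> * b" "- \<i> * (a\<^sup>2 - \<beta>) * t" x]
  by (simp add: e_def algebra_simps)

lemma e_t: "((\<lambda>s. e x s) has_vector_derivative \<i> * (\<beta> - a\<^sup>2) * e x t) (at t)"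
  using has_vector_derivative_exp_affine[of "\<i> * (\<beta> - a\<^sup>2)" "\<i> * b * x" t]
  by (simp add: e_def algebra_simps)

text \<open>The phase is real because \<open>a\<close>, \<open>b\<close> and \<open>\<beta>\<close>
  are. Hence the carrier wave drops out of every product of a field with a conjugated field.\<close>

lemma e_cnj_e: "e x t * cnj (e x t) = 1"
proof -
  let ?y = "\<i> * (b * x - (a\<^sup>2 - \<beta>) * t)"
  have "cnj (e x t) = exp (cnj ?y)"
    unfolding e_def by (rule exp_cnj)
  also have "cnj ?y = - ?y"
    by (simp add: reals \<beta>_real)
  finally show ?thesis
    by (simp add: e_def exp_minus_inverse)
qed

definition u1 where "u1 x t = a * (N x t / M x t) * e x t"
definition u2 where "u2 x t = X x t * cnj (p x t) / M x t * e x t"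

definition u1x where
  "u1x x t = - (\<i> * a * b * (cnj (M x t) * (M x t - q x t * h x t) / (M x t)\<^sup>2) * e x t)"
definition u2x where
  "u2x x t = \<i> * (cnj (M x t) * X x t * h x t / (M x t)\<^sup>2) * e x t"

definition u1t where
  "u1t x t = a * (\<i> / 2 * ((m x t + b * (Q x t * cnj (p x t) - q x t * cnj (P x t))) * M x t
      - N x t * m x t) / (M x t)\<^sup>2 + N x t / M x t * (\<i> * (\<beta> - a\<^sup>2))) * e x t"
definition u2t where
  "u2t x t = (\<i> / 2 * (X x t * ((z * \<beta>\<^sup>2 - w) * cnj (p x t) - cnj (P x t)) * M x t
      - X x t * cnj (p x t) * m x t) / (M x t)\<^sup>2 + X x t * cnj (p x t) / M x t * (\<i> * (\<beta> - a\<^sup>2))) * e x t"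

text \<open>The t-derivative of M' (M - q h), the numerator in \<open>u1x\<close>, divided by
  \<open>\<i> / 2\<close>.\<close>

definition \<Gamma> where
  "\<Gamma> x t = m' x t * (M x t - q x t * h x t) + cnj (M x t) * (m x t - Q x t * h x t + q x t * k x t)"
text \<open>The t-derivative of M' X h, the numerator in \<open>u2x\<close>, divided by
  \<open>\<i> / 2\<close> and by \<open>X\<close>; the middle term comes from
  \<open>X_t\<close>.\<close>

definition \<Lambda> where
  "\<Lambda> x t = m' x t * h x t + cnj (M x t) * (z * \<beta>\<^sup>2 - w) * h x t - cnj (M x t) * k x t"

definition u1xt where
  "u1xt x t = - (\<i> * a * b * (\<i> * (\<beta> - a\<^sup>2) * (cnj (M x t) * (M x t - q x t * h x t) / (M x t)\<^sup>2)
     + \<i> / 2 * (M x t * \<Gamma> x t - 2 * m x t * cnj (M x t) * (M x t - q x t * h x t)) / M x t ^ 3) * e x t)"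
definition u2xt where
  "u2xt x t = \<i> * (\<i> * (\<beta> - a\<^sup>2) * (cnj (M x t) * X x t * h x t / (M x t)\<^sup>2)
     + \<i> / 2 * X x t * (M x t * \<Lambda> x t - 2 * m x t * cnj (M x t) * h x t) / M x t ^ 3) * e x t"

text \<open>Over the divisor M^2 the quotient rule and the carrier together give
  \<open>\<i> * a * b\<close> times M (M + |p|^2) - q h (M + |p|^2): the mixed terms collect exactly
  to \<open>h\<close>. By \<open>cnj_M\<close> the common factor M + |p|^2 is -M'.\<close>

lemma u1_x: "((\<lambda>s. u1 s t) has_vector_derivative u1x x t) (at x)" if nz: "M x t \<noteq> 0"
  unfolding u1_def N_def
  apply (rule has_vector_derivative_eq_rhs)
   apply (rule has_vector_derivative_quotient derivative_intros p_x q_x e_x M_x nz)+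
  unfolding u1x_def cnj_M
  using nz by (simp add: divide_simps, unfold h_def, simp add: reals) algebra

text \<open>The same collection of terms gives -h (M + |p|^2), and \<open>cnj_M\<close> turns it
  into h M'.\<close>

lemma u2_x: "((\<lambda>s. u2 s t) has_vector_derivative u2x x t) (at x)" if nz: "M x t \<noteq> 0"
  unfolding u2_def
  apply (rule has_vector_derivative_eq_rhs)
   apply (rule has_vector_derivative_quotient derivative_intros p_x q_x X_x e_x M_x nz)+
  unfolding u2x_def cnj_M
  using nz by (simp add: divide_simps, unfold h_def, simp add: reals) algebra

lemma u1_t: "((\<lambda>s. u1 x s) has_vector_derivative u1t x t) (at t)" if nz: "M x t \<noteq> 0"
  unfolding u1_def
  apply (rule has_vector_derivative_eq_rhs)
   apply (rule has_vector_derivative_quotient derivative_intros N_t e_t M_t nz)+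
  unfolding u1t_def
  using nz by (simp add: divide_simps) algebra

lemma u2_t: "((\<lambda>s. u2 x s) has_vector_derivative u2t x t) (at t)" if nz: "M x t \<noteq> 0"
  unfolding u2_def
  apply (rule has_vector_derivative_eq_rhs)
   apply (rule has_vector_derivative_quotient derivative_intros X_t p_t e_t M_t nz)+
  unfolding u2t_def
  using nz by (simp add: divide_simps) algebra

lemma u1_xt: "((\<lambda>s. u1x x s) has_vector_derivative u1xt x t) (at t)" if nz: "M x t \<noteq> 0"
  \<comment> \<open>Written as a product, the squared denominator is differentiated by the product
    rule, and \<open>no_zero_divisors\<close> shows that it does not vanish.\<close>
  unfolding u1x_def power2_eq_square[of "M _ _"]
  apply (rule has_vector_derivative_eq_rhs)
   \<comment> \<open>\<open>cnj_M_t\<close> is listed first so that the conjugate of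
     \<open>M\<close> contributes \<open>m'\<close> instead of being handled by the general rule for
     conjugates.\<close>
   apply (rule cnj_M_t has_vector_derivative_quotient derivative_intros q_t h_t e_t M_t no_zero_divisors nz)+
  unfolding u1xt_def \<Gamma>_def
  using nz by (simp add: divide_simps) algebra

lemma u2_xt: "((\<lambda>s. u2x x s) has_vector_derivative u2xt x t) (at t)" if nz: "M x t \<noteq> 0"
  unfolding u2x_def power2_eq_square[of "M _ _"]
  apply (rule has_vector_derivative_eq_rhs)
   apply (rule cnj_M_t has_vector_derivative_quotient derivative_intros X_t h_t e_t M_t no_zero_divisors nz)+
  unfolding u2xt_def \<Lambda>_def
  using nz by (simp add: divide_simps) algebra

section \<open>Verification of the coupled system\<close>

lemma solution:
  assumes "\<sigma> = of_real s"
  shows "coupled_FL_solution_on s {(x, t). M x t \<noteq> 0} u1 u2"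
proof -
  \<comment> \<open>Continuity is built in layers, each declared before the functions that depend on
    it. The form with \<open>fst\<close> and \<open>snd\<close> is the one that
    \<open>case_prod_beta\<close> produces.\<close>
  have [continuous_intros]: "continuous_on D (\<lambda>y. p (fst y) (snd y))"
    "continuous_on D (\<lambda>y. q (fst y) (snd y))" "continuous_on D (\<lambda>y. X (fst y) (snd y))" for D
    using p_cont q_cont X_cont continuous_on_subset by blast+
  have [continuous_intros]: "continuous_on D (\<lambda>y. P (fst y) (snd y))"
     "continuous_on D (\<lambda>y. Q (fst y) (snd y))" "continuous_on D (\<lambda>y. M (fst y) (snd y))" for D
    unfolding P Q M_def using w_nonreal by (auto intro!: continuous_intros)
  have [continuous_intros]: "continuous_on D (\<lambda>y. h (fst y) (snd y))"
    "continuous_on D (\<lambda>y. k (fst y) (snd y))" "continuous_on D (\<lambda>y. m (fst y) (snd y))"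
    "continuous_on D (\<lambda>y. N (fst y) (snd y))" "continuous_on D (\<lambda>y. e (fst y) (snd y))" for D
    unfolding h_def k_def m_def N_def e_def by (auto intro!: continuous_intros)
  have [continuous_intros]: "continuous_on D (\<lambda>y. m' (fst y) (snd y))" for D
    unfolding m'_def by (auto intro!: continuous_intros)
  let ?D = "{(x, t). M x t \<noteq> 0}"
  have "open ?D"
    unfolding case_prod_beta by (intro open_Collect_neq continuous_intros)
  moreover have
     "continuous_on ?D (\<lambda>(x, t). u1 x t)" "continuous_on ?D (\<lambda>(x, t). u2 x t)"
     "continuous_on ?D (\<lambda>(x, t). u1x x t)" "continuous_on ?D (\<lambda>(x, t). u2x x t)"
     "continuous_on ?D (\<lambda>(x, t). u1t x t)" "continuous_on ?D (\<lambda>(x, t). u2t x t)"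
     "continuous_on ?D (\<lambda>(x, t). u1xt x t)" "continuous_on ?D (\<lambda>(x, t). u2xt x t)"
    unfolding case_prod_beta u1_def u2_def u1x_def u2x_def u1t_def u2t_def u1xt_def u2xt_def \<Gamma>_def \<Lambda>_def
    by (auto intro!: continuous_intros)
  moreover have "u1xt x t + u1 x t
          + \<i> * complex_of_real ((cmod (u1 x t))\<^sup>2 + 1/2 * s * (cmod (u2 x t))\<^sup>2) * u1x x t
          + \<i> / 2 * complex_of_real s * u1 x t * cnj (u2 x t) * u2x x t = 0"
       "u2xt x t + u2 x t
          + \<i> * complex_of_real (s * (cmod (u2 x t))\<^sup>2 + 1/2 * (cmod (u1 x t))\<^sup>2) * u2x x t
          + \<i> / 2 * u2 x t * cnj (u1 x t) * u1x x t = 0"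
     if nz: "M x t \<noteq> 0" for x t
  proof -
    have nz': "cnj (M x t) \<noteq> 0" using nz by simp
    \<comment> \<open>Solving \<open>M_eq\<close> for \<sigma> |X|^2 eliminates \<open>X\<close>
      from the polynomial identities.\<close>
    have S: "\<sigma> * X x t * cnj (X x t) = w * p x t * cnj (p x t) - a\<^sup>2 * b\<^sup>2 * q x t * cnj (q x t) - (cnj w - w) * M x t"
      using M_eq[of x t] by algebra
    have P': "cnj (P x t) = (2 * \<beta> + cnj z * \<beta>\<^sup>2 - a\<^sup>2) * cnj (p x t) - a\<^sup>2 * b * cnj (q x t)"
      and Q': "cnj (Q x t) = \<beta> * cnj w * cnj (p x t) + (cnj z * \<beta>\<^sup>2 - cnj w - a\<^sup>2) * cnj (q x t)"
      and N': "cnj (N x t) = cnj (M x t) + b * cnj (q x t) * p x t"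
      by (simp_all add: P Q N_def reals \<beta>_real)
    \<comment> \<open>Listed in the order of the hypotheses of the two identities; folding
      \<open>\<Gamma>\<close> and \<open>\<Lambda>\<close> afterwards gives the shape that the
      quotient lemmas expect.\<close>
    note facts = b_\<beta> z_w cnj_z_w S cnj_M P Q P' Q' m_def m'_def h_def k_def N_def N'
    note F1 = first_equation_identity[OF facts]
    note F2 = second_equation_identity[OF facts]
    note F1 = first_equation_quotients[OF nz nz' b_\<beta> F1[folded \<Gamma>_def], where a = a and e = "e x t"]
    note F2 = second_equation_quotients[OF nz nz' power2_eq_square F2[folded \<Lambda>_def], where e = "e x t"]
    have ee: "e x t * cnj (e x t) = 1" by (rule e_cnj_e)
    have n1: "complex_of_real ((cmod (u1 x t))\<^sup>2) = a\<^sup>2 * N x t * cnj (N x t) / (M x t * cnj (M x t))"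
    proof -
      have "complex_of_real ((cmod (u1 x t))\<^sup>2) =
          a\<^sup>2 * N x t * cnj (N x t) / (M x t * cnj (M x t)) * (e x t * cnj (e x t))"
        unfolding complex_norm_square u1_def by (simp add: reals power2_eq_square)
      then show ?thesis by (simp add: ee)
    qed
    have n2: "complex_of_real ((cmod (u2 x t))\<^sup>2) =
          X x t * cnj (X x t) * p x t * cnj (p x t) / (M x t * cnj (M x t))"
    proof -
      have "complex_of_real ((cmod (u2 x t))\<^sup>2) =
          X x t * cnj (X x t) * p x t * cnj (p x t) / (M x t * cnj (M x t)) * (e x t * cnj (e x t))"
        unfolding complex_norm_square u2_def by (simp add: reals power2_eq_square)
      then show ?thesis by (simp add: ee)
    qed
    have n3: "u1 x t * cnj (u2 x t) = a * N x t * cnj (X x t) * p x t / (M x t * cnj (M x t))"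
    proof -
      have "u1 x t * cnj (u2 x t) = a * N x t * cnj (X x t) * p x t / (M x t * cnj (M x t)) * (e x t * cnj (e x t))"
        unfolding u1_def u2_def by (simp add: reals)
      then show ?thesis by (simp add: ee)
    qed
    have n4: "u2 x t * cnj (u1 x t) = a * X x t * cnj (p x t) * cnj (N x t) / (M x t * cnj (M x t))"
    proof -
      have "u2 x t * cnj (u1 x t) = a * X x t * cnj (p x t) * cnj (N x t) / (M x t * cnj (M x t)) * (e x t * cnj (e x t))"
        unfolding u1_def u2_def by (simp add: reals)
      then show ?thesis by (simp add: ee)
    qed
    have k1: "complex_of_real ((cmod (u1 x t))\<^sup>2 + 1/2 * s * (cmod (u2 x t))\<^sup>2) =
        a\<^sup>2 * N x t * cnj (N x t) / (M x t * cnj (M x t))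
        + \<sigma> / 2 * X x t * cnj (X x t) * p x t * cnj (p x t) / (M x t * cnj (M x t))"
      unfolding of_real_add of_real_mult n1 n2 assms[symmetric] by simp
    have k2: "complex_of_real (s * (cmod (u2 x t))\<^sup>2 + 1/2 * (cmod (u1 x t))\<^sup>2) =
        \<sigma> * X x t * cnj (X x t) * p x t * cnj (p x t) / (M x t * cnj (M x t))
        + 1 / 2 * (a\<^sup>2 * N x t * cnj (N x t) / (M x t * cnj (M x t)))"
      unfolding of_real_add of_real_mult n1 n2 assms[symmetric] by simp
    have n3': "\<i> / 2 * complex_of_real s * u1 x t * cnj (u2 x t) =
        \<i> / 2 * \<sigma> * (a * N x t * cnj (X x t) * p x t / (M x t * cnj (M x t)))"
      unfolding assms[symmetric] n3[symmetric] by (simp only: mult.assoc)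
    have n4': "\<i> / 2 * u2 x t * cnj (u1 x t) =
        \<i> / 2 * (a * X x t * cnj (p x t) * cnj (N x t) / (M x t * cnj (M x t)))"
      unfolding n4[symmetric] by (simp only: mult.assoc)
    show "u1xt x t + u1 x t
          + \<i> * complex_of_real ((cmod (u1 x t))\<^sup>2 + 1/2 * s * (cmod (u2 x t))\<^sup>2) * u1x x t
          + \<i> / 2 * complex_of_real s * u1 x t * cnj (u2 x t) * u2x x t = 0"
      unfolding k1 n3' using F1 by (simp only: u1xt_def u1_def u1x_def u2x_def)
    show "u2xt x t + u2 x t
          + \<i> * complex_of_real (s * (cmod (u2 x t))\<^sup>2 + 1/2 * (cmod (u1 x t))\<^sup>2) * u2x x t
          + \<i> / 2 * u2 x t * cnj (u1 x t) * u1x x t = 0"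
      unfolding k2 n4' using F2 by (simp only: u2xt_def u2_def u1x_def u2x_def)
  qed
  ultimately show ?thesis
    using u1_x u1_t u1_xt u2_x u2_t u2_xt
    by (intro coupled_FL_solution_onI[where u1x = u1x and u1t = u1t and u1xt = u1xt
        and u2x = u2x and u2t = u2t and u2xt = u2xt]) auto
qed

end

section \<open>The explicit breather formulas as an instance of the dressing\<close>

theorem mainTheorem9:
  fixes \<sigma> a\<^sub>1 b\<^sub>1 :: real
    and \<mu>\<^sub>1 z\<^sub>1 :: complex
    and c \<kappa> :: "nat \<Rightarrow> complex"
    and \<omega>\<^sub>1 :: "real \<Rightarrow> real \<Rightarrow> real"
    and \<theta> :: "nat \<Rightarrow> real \<Rightarrow> real \<Rightarrow> complex"
    and A B :: "nat \<Rightarrow> nat \<Rightarrow> complex"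
    and N\<^sub>1 N\<^sub>2 M\<^sub>1 :: "real \<Rightarrow> real \<Rightarrow> complex"
  assumes sigma: "\<sigma> = 1 \<or> \<sigma> = -1"
    and a1: "a\<^sub>1 \<noteq> 0"
    and b1: "b\<^sub>1 \<noteq> 0"
    and lambda1: "\<mu>\<^sub>1 \<notin> \<real> \<union> (\<lambda>y. \<i> * complex_of_real y) ` UNIV"
    and z1: "z\<^sub>1 = \<mu>\<^sub>1 powi (-2)"
    and roots: "{k. (k / z\<^sub>1 - 2) * (k + complex_of_real b\<^sub>1)
                     + complex_of_real (a\<^sub>1\<^sup>2 * b\<^sub>1\<^sup>2) = 0} = {\<kappa> 1, \<kappa> 2}"
    and roots_degenerate: "2 * b\<^sub>1 - a\<^sub>1\<^sup>2 * b\<^sub>1\<^sup>2 = 0 \<Longrightarrow>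
                     \<kappa> 1 = 2 * z\<^sub>1 - complex_of_real b\<^sub>1 \<and> \<kappa> 2 = 0"
    and kappa3: "\<kappa> 3 = - complex_of_real b\<^sub>1"
    and omega1: "\<And>x t. \<omega>\<^sub>1 x t = b\<^sub>1 * x - (a\<^sub>1\<^sup>2 - 1 / b\<^sub>1) * t"
    and theta: "\<And>i x t. \<theta> i x t = \<i> * (\<kappa> i - z\<^sub>1) *
                  (complex_of_real x
                   + 1 / (2 * (complex_of_real b\<^sub>1)\<^sup>2 * z\<^sub>1)
                     * (\<kappa> i - z\<^sub>1 + 2 * complex_of_real b\<^sub>1) * complex_of_real t)"
    and A: "\<And>l m. A l m =
              (if 2 * b\<^sub>1 - a\<^sub>1\<^sup>2 * b\<^sub>1\<^sup>2 = 0 \<and> l = 2 \<and> m = 2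
               then complex_of_real ((cmod (c 2))\<^sup>2) * z\<^sub>1\<^sup>2
                      * (complex_of_real (a\<^sub>1\<^sup>2) * cnj z\<^sub>1 - 1)
                    / (complex_of_real ((cmod z\<^sub>1)\<^sup>2) - z\<^sub>1\<^sup>2)
               else (cnj (\<kappa> l) + complex_of_real b\<^sub>1) / (\<kappa> m + complex_of_real b\<^sub>1)
                    * (c m * cnj (c l) * \<kappa> m / (\<kappa> m - cnj (\<kappa> l))))"
    and B: "\<And>l m. B l m =
              (if 2 * b\<^sub>1 - a\<^sub>1\<^sup>2 * b\<^sub>1\<^sup>2 = 0 \<and> l = 2 \<and> m = 2
               then complex_of_real ((cmod (c 2))\<^sup>2) * complex_of_real ((cmod z\<^sub>1)\<^sup>2)
                      * (complex_of_real (a\<^sub>1\<^sup>2) * z\<^sub>1 - 1)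
                    / (complex_of_real ((cmod z\<^sub>1)\<^sup>2) - z\<^sub>1\<^sup>2)
               else c m * cnj (c l) * cnj (\<kappa> l) / (\<kappa> m - cnj (\<kappa> l)))"
    and N1: "\<And>x t. N\<^sub>1 x t =
              (\<Sum>l\<in>{1..2}. \<Sum>m\<in>{1..2}. A l m * exp (\<theta> m x t + cnj (\<theta> l x t)))
              + complex_of_real (\<sigma> * (cmod (c 3))\<^sup>2 * cmod z\<^sub>1) / (cnj z\<^sub>1 - z\<^sub>1)
                * exp (\<theta> 3 x t + cnj (\<theta> 3 x t))"
    and M1: "\<And>x t. M\<^sub>1 x t =
              (\<Sum>l\<in>{1..2}. \<Sum>m\<in>{1..2}. B l m * exp (\<theta> m x t + cnj (\<theta> l x t)))
              + complex_of_real (\<sigma> * (cmod (c 3))\<^sup>2 * cmod z\<^sub>1) / (cnj z\<^sub>1 - z\<^sub>1)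
                * exp (\<theta> 3 x t + cnj (\<theta> 3 x t))"
    and N2: "\<And>x t. N\<^sub>2 x t = c 3 * \<mu>\<^sub>1 *
              (cnj (c 1) * exp (\<theta> 3 x t + cnj (\<theta> 1 x t))
               + cnj (c 2) * exp (\<theta> 3 x t + cnj (\<theta> 2 x t)))"
  shows "coupled_FL_solution_on \<sigma> {(x, t). M\<^sub>1 x t \<noteq> 0}
           (\<lambda>x t. complex_of_real a\<^sub>1 * (N\<^sub>1 x t / M\<^sub>1 x t) * exp (\<i> * complex_of_real (\<omega>\<^sub>1 x t)))
           (\<lambda>x t. N\<^sub>2 x t / M\<^sub>1 x t * exp (\<i> * complex_of_real (\<omega>\<^sub>1 x t)))"
proof -
  let ?a = "complex_of_real a\<^sub>1" and ?b = "complex_of_real b\<^sub>1"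
  define g where "g = ?a\<^sup>2 * ?b\<^sup>2"
  define \<beta> where "\<beta> = complex_of_real (1 / b\<^sub>1)"
  define w where "w = \<mu>\<^sub>1\<^sup>2"
  define r where "r i = 1 / (\<kappa> i + ?b)" for i
  define E where "E i x t = exp (\<theta> i x t)" for i x t
  define p where "p x t = c 1 * E 1 x t + c 2 * E 2 x t" for x t
  define q where "q x t = c 1 * r 1 * E 1 x t + c 2 * r 2 * E 2 x t" for x t
  define X where "X x t = \<mu>\<^sub>1 * c 3 * E 3 x t" for x t
  define P where "P x t = (2 * \<beta> + z\<^sub>1 * \<beta>\<^sup>2 - ?a\<^sup>2) * p x t - ?a\<^sup>2 * ?b * q x t" for x t
  define Q where "Q x t = \<beta> * w * p x t + (z\<^sub>1 * \<beta>\<^sup>2 - w - ?a\<^sup>2) * q x t" for x t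
  have mu: "Re \<mu>\<^sub>1 \<noteq> 0" "Im \<mu>\<^sub>1 \<noteq> 0"
    using lambda1 by (auto simp: complex_is_Real_iff image_iff complex_eq_iff)
  then have mu_nz: "\<mu>\<^sub>1 \<noteq> 0" by auto
  have zw: "z\<^sub>1 * w = 1"
    using mu_nz by (simp add: z1 w_def power_int_minus)
  have czw: "cnj z\<^sub>1 * cnj w = 1"
    using arg_cong[OF zw, of cnj] by simp
  have b\<beta>: "?b * \<beta> = 1"
    using b1 by (simp add: \<beta>_def)
  have z_nz: "z\<^sub>1 \<noteq> 0" using zw by auto
  \<comment> \<open>The imaginary part of \<lambda>_1^2 is twice the product of the real and
    imaginary parts of \<lambda>_1, so avoiding both axes is what makes \<open>w\<close>
    non-real.\<close>
  have "cnj w \<noteq> w"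
    using mu by (simp add: w_def complex_eq_iff power2_eq_square)
  then have z_nonreal: "cnj z\<^sub>1 \<noteq> z\<^sub>1"
    using zw czw z_nz by (metis mult_left_cancel)
  have root: "(k / z\<^sub>1 - 2) * (k + ?b) + g = 0" if "k = \<kappa> 1 \<or> k = \<kappa> 2" for k
    using roots that by (auto simp: g_def)
  \<comment> \<open>At \<kappa> = -b_1 the quadratic reduces to g = 0, which is excluded, so
    \<open>r\<close> is a true reciprocal. Dividing the quadratic by \<kappa> + b_1 then makes
    \<kappa> affine in \<open>r\<close> with coefficients independent of the index; this is why
    \<open>p\<close> and \<open>q\<close> close up into a linear system.\<close>
  have r: "(\<kappa> i + ?b) * r i = 1" and kr: "\<kappa> i = 2 * z\<^sub>1 - z\<^sub>1 * g * r i" if "i = 1 \<or> i = 2" for i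
  proof -
    have "\<kappa> i + ?b \<noteq> 0"
      using root[of "\<kappa> i"] that a1 b1 by (auto simp: g_def)
    then show 1: "(\<kappa> i + ?b) * r i = 1" by (simp add: r_def)
    have "(\<kappa> i - 2 * z\<^sub>1) * (\<kappa> i + ?b) + z\<^sub>1 * g = 0"
      using root[of "\<kappa> i"] that z_nz by (auto simp: field_simps)
    then show "\<kappa> i = 2 * z\<^sub>1 - z\<^sub>1 * g * r i" using 1 by algebra
  qed
  have "w = 1 / z\<^sub>1"
    using zw z_nz by (simp add: field_simps)
  then have w\<beta>: "1 / (2 * ?b\<^sup>2 * z\<^sub>1) = w * \<beta>\<^sup>2 / 2"
    by (simp add: \<beta>_def power_divide)
  \<comment> \<open>With the coefficient of \<open>t\<close> opaque, splitting the phase into its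
    x-part and t-part needs ring normalisation only.\<close>
  define v where "v = 1 / (2 * ?b\<^sup>2 * z\<^sub>1)"
  have \<theta>_x: "\<theta> i x t = \<i> * (\<kappa> i - z\<^sub>1) * of_real x + \<theta> i 0 t"
    and \<theta>_t: "\<theta> i x t = \<i> * (\<kappa> i - z\<^sub>1) * v * (\<kappa> i - z\<^sub>1 + 2 * ?b) * of_real t + \<theta> i x 0" for i x t
    unfolding theta v_def[symmetric] by (simp_all add: algebra_simps)
  have speed_eq: "\<i> * (\<kappa> i - z\<^sub>1) * v * (\<kappa> i - z\<^sub>1 + 2 * ?b) =
      \<i> / 2 * (w * \<beta>\<^sup>2 * (\<kappa> i - z\<^sub>1) * (\<kappa> i - z\<^sub>1 + 2 * ?b))" for i
    by (simp add: v_def w\<beta>)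
  have E_x: "((\<lambda>s. E i s t) has_vector_derivative \<i> * (\<kappa> i - z\<^sub>1) * E i x t) (at x)" for i x t
    unfolding E_def using has_vector_derivative_exp_affine[of "\<i> * (\<kappa> i - z\<^sub>1)" "\<theta> i 0 t" x]
    by (simp only: \<theta>_x[symmetric])
  have E_t: "((\<lambda>s. E i x s) has_vector_derivative
      \<i> / 2 * (w * \<beta>\<^sup>2 * (\<kappa> i - z\<^sub>1) * (\<kappa> i - z\<^sub>1 + 2 * ?b)) * E i x t) (at t)" for i x t
    unfolding E_def speed_eq[symmetric]
    using has_vector_derivative_exp_affine[of "\<i> * (\<kappa> i - z\<^sub>1) * v * (\<kappa> i - z\<^sub>1 + 2 * ?b)" "\<theta> i x 0" t]
    by (simp only: \<theta>_t[symmetric])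
  have E_cont: "continuous_on UNIV (\<lambda>y. E i (fst y) (snd y))" for i
    unfolding E_def theta by (intro continuous_intros)
  note r1 = r[OF disjI1[OF refl]] and r2 = r[OF disjI2[OF refl]]
  note kr1 = kr[OF disjI1[OF refl]] and kr2 = kr[OF disjI2[OF refl]]
  interpret darboux_dressing "of_real \<sigma>" ?a ?b \<beta> z\<^sub>1 w p q X P Q
  proof
    fix x t
    show "((\<lambda>s. p s t) has_vector_derivative
        \<i> * z\<^sub>1 * (p x t - ?a\<^sup>2 * ?b\<^sup>2 * q x t)) (at x)"
      unfolding p_def
    proof (rule has_vector_derivative_eq_rhs, (rule derivative_intros E_x)+, goal_cases)
      case 1
      show ?case unfolding q_def g_def[symmetric] using kr1 kr2 by algebra
    qed
    show "((\<lambda>s. q s t) has_vector_derivative \<i> * (p x t - (?b + z\<^sub>1) * q x t)) (at x)"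
      unfolding q_def
    proof (rule has_vector_derivative_eq_rhs, (rule derivative_intros E_x)+, goal_cases)
      case 1
      show ?case unfolding p_def using r1 r2 by algebra
    qed
    show "((\<lambda>s. X s t) has_vector_derivative - (\<i> * (?b + z\<^sub>1) * X x t)) (at x)"
      unfolding X_def
      by (rule has_vector_derivative_eq_rhs, (rule derivative_intros E_x)+)
         (simp add: kappa3 algebra_simps)
    \<comment> \<open>The rate in \<open>t\<close> is quadratic in \<kappa>, so the root equation
      makes it affine in \<open>r\<close>, and likewise after multiplication by \<open>r\<close>.
      The coefficients do not depend on the index, and the sums become \<open>P\<close> and
      \<open>Q\<close>.\<close>
    have speed: "w * \<beta>\<^sup>2 * (\<kappa> i - z\<^sub>1) * (\<kappa> i - z\<^sub>1 + 2 * ?b) = 2 * \<beta> + z\<^sub>1 * \<beta>\<^sup>2 - ?a\<^sup>2 - ?a\<^sup>2 * ?b * r i"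
      and speed': "w * \<beta>\<^sup>2 * (\<kappa> i - z\<^sub>1) * (\<kappa> i - z\<^sub>1 + 2 * ?b) * r i = \<beta> * w + (z\<^sub>1 * \<beta>\<^sup>2 - w - ?a\<^sup>2) * r i"
      if "i = 1 \<or> i = 2" for i
      using r[OF that] kr[OF that] zw b\<beta> unfolding g_def by algebra+
    show "((\<lambda>s. p x s) has_vector_derivative \<i> / 2 * P x t) (at t)"
      unfolding p_def
    proof (rule has_vector_derivative_eq_rhs, (rule derivative_intros E_t)+, goal_cases)
      case 1
      show ?case unfolding P_def p_def q_def speed[OF disjI1[OF refl]] speed[OF disjI2[OF refl]]
        by (simp add: algebra_simps)
    qed
    show "((\<lambda>s. q x s) has_vector_derivative \<i> / 2 * Q x t) (at t)"
      unfolding q_def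
    proof (rule has_vector_derivative_eq_rhs, (rule derivative_intros E_t)+, goal_cases)
      case 1
      show ?case unfolding Q_def p_def q_def
        using speed'[OF disjI1[OF refl]] speed'[OF disjI2[OF refl]] by algebra
    qed
    show "((\<lambda>s. X x s) has_vector_derivative \<i> / 2 * (z\<^sub>1 * \<beta>\<^sup>2 - w) * X x t) (at t)"
      unfolding X_def
    proof (rule has_vector_derivative_eq_rhs, (rule derivative_intros E_t)+, goal_cases)
      case 1
      have "w * \<beta>\<^sup>2 * (\<kappa> 3 - z\<^sub>1) * (\<kappa> 3 - z\<^sub>1 + 2 * ?b) = z\<^sub>1 * \<beta>\<^sup>2 - w"
        unfolding kappa3 using zw b\<beta> by algebra
      then show ?case by simp
    qed
  qed (use zw b\<beta> z_nonreal E_cont in \<open>auto simp: P_def Q_def p_def q_def X_def intro!: continuous_intros\<close>)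

  \<comment> \<open>Matching the dressed quantities with the explicit sums\<close>
  have cnj_g: "cnj g = g" by (simp add: g_def)
  \<comment> \<open>\<open>B l m\<close> without the divisor \<open>\<kappa> m - cnj (\<kappa> l)\<close>: this is where the two cases merge\<close>
  have B_eq: "(cnj w - w) * B l m = c m * cnj (c l) * (w - g * r m * cnj (r l))"
    and A_eq: "A l m = B l m + ?b * c m * cnj (c l) * r m"
    if l: "l = 1 \<or> l = 2" and m: "m = 1 \<or> m = 2" for l m
  proof -
    have rl: "(cnj (\<kappa> l) + ?b) * cnj (r l) = 1"
      using arg_cong[OF r[OF l], of cnj] by simp
    have krl: "cnj (\<kappa> l) = 2 * cnj z\<^sub>1 - cnj z\<^sub>1 * g * cnj (r l)"
      using arg_cong[OF kr[OF l], of cnj] by (simp add: cnj_g)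
    \<comment> \<open>Subtract w' \<kappa>_l' = 2 - g r_l' from w \<kappa>_m = 2 - g r_m and use
      r_l' - r_m = (\<kappa>_m - \<kappa>_l') r_m r_l'.\<close>
    have key: "(cnj w - w) * cnj (\<kappa> l) = (\<kappa> m - cnj (\<kappa> l)) * (w - g * r m * cnj (r l))"
      using r[OF m] rl kr[OF m] krl zw czw by algebra
    have "(cnj w - w) * B l m = c m * cnj (c l) * (w - g * r m * cnj (r l))
        \<and> A l m = B l m + ?b * c m * cnj (c l) * r m"
    proof (cases "2 * b\<^sub>1 - a\<^sub>1\<^sup>2 * b\<^sub>1\<^sup>2 = 0 \<and> l = 2 \<and> m = 2")
      case True
      then have lm: "l = 2" "m = 2" and k2: "\<kappa> 2 = 0" and ab: "a\<^sub>1\<^sup>2 * b\<^sub>1 = 2"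
        using roots_degenerate b1 by (auto simp: power2_eq_square)
      have a2: "of_real (a\<^sub>1\<^sup>2) * ?b = 2"
        using arg_cong[OF ab, of complex_of_real] by simp
      have r2: "r 2 = \<beta>" and c\<beta>: "cnj \<beta> = \<beta>"
        by (simp_all add: r_def k2 \<beta>_def)
      have gb: "g = of_real (a\<^sub>1\<^sup>2) * ?b\<^sup>2" by (simp add: g_def)
      have d: "cnj z\<^sub>1 - z\<^sub>1 \<noteq> 0" using z_nonreal by simp
      \<comment> \<open>Since |z_1|^2 - z_1^2 = z_1 (z_1' - z_1), the prescribed coefficient has a
        removable factor z_1, displayed here for cancellation.\<close>
      have "B l m = z\<^sub>1 * (c 2 * cnj (c 2) * cnj z\<^sub>1 * (of_real (a\<^sub>1\<^sup>2) * z\<^sub>1 - 1)) / (z\<^sub>1 * (cnj z\<^sub>1 - z\<^sub>1))"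
        unfolding B using True by (simp only: complex_norm_square) (simp add: algebra_simps power2_eq_square)
      then have B': "B l m * (cnj z\<^sub>1 - z\<^sub>1) = c 2 * cnj (c 2) * cnj z\<^sub>1 * (of_real (a\<^sub>1\<^sup>2) * z\<^sub>1 - 1)"
        using z_nz d by simp
      have "A l m = z\<^sub>1 * (c 2 * cnj (c 2) * z\<^sub>1 * (of_real (a\<^sub>1\<^sup>2) * cnj z\<^sub>1 - 1)) / (z\<^sub>1 * (cnj z\<^sub>1 - z\<^sub>1))"
        unfolding A using True by (simp only: complex_norm_square) (simp add: algebra_simps power2_eq_square)
      then have A': "A l m * (cnj z\<^sub>1 - z\<^sub>1) = c 2 * cnj (c 2) * z\<^sub>1 * (of_real (a\<^sub>1\<^sup>2) * cnj z\<^sub>1 - 1)"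
        using z_nz d by simp
      have "(cnj w - w) * B l m * (cnj z\<^sub>1 - z\<^sub>1) = c 2 * cnj (c 2) * (w - g * \<beta> * \<beta>) * (cnj z\<^sub>1 - z\<^sub>1)"
        using B' gb a2 b\<beta> zw czw by algebra
      moreover have "A l m * (cnj z\<^sub>1 - z\<^sub>1) = (B l m + ?b * c 2 * cnj (c 2) * \<beta>) * (cnj z\<^sub>1 - z\<^sub>1)"
        using A' B' b\<beta> by algebra
      ultimately show ?thesis
        unfolding lm r2 c\<beta> using d by simp
    next
      case False
      \<comment> \<open>A vanishing divisor forces \<kappa>_l = \<kappa>_m = 0 by
        \<open>key\<close>. The root equation at 0 is then the degeneracy condition, under which
        \<kappa>_1 = 2 z_1 - b_1 is nonzero because z_1 is not real; so l = m = 2, the excluded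
        case.\<close>
      have nz: "\<kappa> m - cnj (\<kappa> l) \<noteq> 0"
      proof
        assume eq: "\<kappa> m - cnj (\<kappa> l) = 0"
        then have k0: "\<kappa> l = 0" "\<kappa> m = 0"
          using key w_nonreal by auto
        then have "complex_of_real (2 * b\<^sub>1) = complex_of_real (a\<^sub>1\<^sup>2 * b\<^sub>1\<^sup>2)"
          using root[of "\<kappa> m"] m by (auto simp: g_def)
        then have deg: "2 * b\<^sub>1 - a\<^sub>1\<^sup>2 * b\<^sub>1\<^sup>2 = 0"
          unfolding of_real_eq_iff by simp
        then have "\<kappa> 1 \<noteq> 0"
          using roots_degenerate z_nonreal by (metis complex_cnj_complex_of_real complex_cnj_mult complex_cnj_numeral eq_iff_diff_eq_0 mult_left_cancel zero_neq_numeral)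
        then show False using False deg k0 l m by auto
      qed
      have B': "B l m * (\<kappa> m - cnj (\<kappa> l)) = c m * cnj (c l) * cnj (\<kappa> l)"
        and A': "A l m * (\<kappa> m - cnj (\<kappa> l)) = (cnj (\<kappa> l) + ?b) * r m * (c m * cnj (c l) * \<kappa> m)"
        unfolding A B if_not_P[OF False] r_def using nz by simp_all
      have "(cnj w - w) * B l m * (\<kappa> m - cnj (\<kappa> l)) =
          c m * cnj (c l) * (w - g * r m * cnj (r l)) * (\<kappa> m - cnj (\<kappa> l))"
        using B' key by algebra
      moreover have "A l m * (\<kappa> m - cnj (\<kappa> l)) =
          (B l m + ?b * c m * cnj (c l) * r m) * (\<kappa> m - cnj (\<kappa> l))"
        using A' B' r[OF m] by algebra
      ultimately show ?thesis
        using nz by simp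
    qed
    then show "(cnj w - w) * B l m = c m * cnj (c l) * (w - g * r m * cnj (r l))"
      and "A l m = B l m + ?b * c m * cnj (c l) * r m" by auto
  qed
  have two: "{1..2} = {1, 2::nat}" by auto
  have exp_E: "exp (\<theta> m x t + cnj (\<theta> l x t)) = E m x t * cnj (E l x t)" for l m x t
    by (simp add: E_def exp_add exp_cnj)
  have "complex_of_real (cmod z\<^sub>1 * (cmod \<mu>\<^sub>1)\<^sup>2) = 1"
    using arg_cong[OF zw, of cmod] by (simp add: w_def norm_mult norm_power)
  then have z_mu: "complex_of_real (cmod z\<^sub>1) * (\<mu>\<^sub>1 * cnj \<mu>\<^sub>1) = 1"
    by (simp only: of_real_mult complex_norm_square)
  \<comment> \<open>Because |z_1| |\<lambda>_1|^2 = 1, the factor |z_1| / (z_1' - z_1) equals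
    -|\<lambda>_1|^2 / (w' - w). This accounts for the factor \<lambda>_1 in
    \<open>X\<close>.\<close>
  define C where "C = complex_of_real (\<sigma> * (cmod (c 3))\<^sup>2 * cmod z\<^sub>1) / (cnj z\<^sub>1 - z\<^sub>1)"
  have "C * (cnj z\<^sub>1 - z\<^sub>1) = complex_of_real \<sigma> * (c 3 * cnj (c 3)) * complex_of_real (cmod z\<^sub>1)"
    unfolding C_def using z_nonreal by (simp only: of_real_mult complex_norm_square) simp
  then have C: "(cnj w - w) * C = - (complex_of_real \<sigma> * (c 3 * cnj (c 3)) * (\<mu>\<^sub>1 * cnj \<mu>\<^sub>1))"
    using z_mu zw czw unfolding w_def by simp algebra
  note Bs = B_eq[OF disjI1[OF refl] disjI1[OF refl]] B_eq[OF disjI1[OF refl] disjI2[OF refl]] B_eq[OF disjI2[OF refl] disjI1[OF refl]] B_eq[OF disjI2[OF refl] disjI2[OF refl]]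
    and As = A_eq[OF disjI1[OF refl] disjI1[OF refl]] A_eq[OF disjI1[OF refl] disjI2[OF refl]] A_eq[OF disjI2[OF refl] disjI1[OF refl]] A_eq[OF disjI2[OF refl] disjI2[OF refl]]
  have M_M1: "M x t = M\<^sub>1 x t" for x t
  proof -
    have "(cnj w - w) * M\<^sub>1 x t =
        (cnj w - w) * B 1 1 * (E 1 x t * cnj (E 1 x t)) + (cnj w - w) * B 1 2 * (E 2 x t * cnj (E 1 x t))
        + (cnj w - w) * B 2 1 * (E 1 x t * cnj (E 2 x t)) + (cnj w - w) * B 2 2 * (E 2 x t * cnj (E 2 x t))
        + (cnj w - w) * C * (E 3 x t * cnj (E 3 x t))"
      unfolding M1 two exp_E C_def[symmetric] by (simp add: algebra_simps)
    also have "\<dots> = (cnj w - w) * M x t"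
      unfolding Bs C M_eq p_def q_def X_def g_def by (simp add: algebra_simps)
    finally show ?thesis
      using w_nonreal by simp
  qed
  \<comment> \<open>The surplus terms of \<open>A_eq\<close> factor as b_1 q p', and the c_3 terms
    of both sums coincide. Removing \<open>One_nat_def\<close> keeps the index 1 in the form used by
    \<open>As\<close>.\<close>
  have N_N1: "N x t = N\<^sub>1 x t" for x t
  proof -
    have "N\<^sub>1 x t = M\<^sub>1 x t + ?b * q x t * cnj (p x t)"
      unfolding N1 M1 two exp_E p_def q_def by (simp add: As algebra_simps del: One_nat_def)
    then show ?thesis
      by (simp add: N_def M_M1)
  qed
  have "u1 = (\<lambda>x t. ?a * (N\<^sub>1 x t / M\<^sub>1 x t) * exp (\<i> * complex_of_real (\<omega>\<^sub>1 x t)))"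
    by (intro ext, unfold u1_def M_M1 N_N1 e_def omega1) (simp add: \<beta>_def)
  moreover have "u2 = (\<lambda>x t. N\<^sub>2 x t / M\<^sub>1 x t * exp (\<i> * complex_of_real (\<omega>\<^sub>1 x t)))"
  proof (intro ext)
    fix x t
    show "u2 x t = N\<^sub>2 x t / M\<^sub>1 x t * exp (\<i> * complex_of_real (\<omega>\<^sub>1 x t))"
      unfolding u2_def M_M1 N2 e_def omega1 exp_E unfolding X_def p_def
      by (simp add: \<beta>_def algebra_simps)
  qed
  ultimately show ?thesis
    using solution[OF refl] unfolding M_M1 by simp
qed

end
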